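(* Let $\mathbb{F}$ be an algebraically closed field of characteristic $p>0$. Any finite-dimensional upper semimodular restricted Lie algebra $L$ over $\mathbb{F}$ that is generated (as a restricted Lie algebra) by its one-dimensional restricted subalgebras is either abelian or almost abelian.
   Context: All algebras are finite-dimensional. $\langle S,T\rangle_p$ denotes the restricted subalgebra generated by $S\cup T$, and "maximal" means maximal among proper restricted subalgebras. A restricted subalgebra $S$ of $L$ is upper semimodular in $L$ if $S$ is maximal in $\langle S,T\rangle_p$ for every restricted subalgebra $T$ of $L$ such that $S\cap T$ is maximal in $T$. $L$ is upper semimodular if all of its restricted subalgebras are upper semimodular in $L$. A Lie algebra $L$ over $\mathbb{F}$ is almost abelian if $L=\mathbb{F}x\dot{+}A$ (vector space direct sum), where $A$ is an abelian ideal of $L$ and $\mathrm{ad}(x)$ acts as the identity map on $A$. *)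

theory Defs
  imports "HOL-Computational_Algebra.Polynomial"
begin

locale lie_algebra = vector_space scale
  for scale :: "'a::field \<Rightarrow> 'b::ab_group_add \<Rightarrow> 'b" +
  fixes bracket :: "'b \<Rightarrow> 'b \<Rightarrow> 'b"
  assumes linear_bracket_right: "Vector_Spaces.linear scale scale (\<lambda>y. bracket x y)"
    and linear_bracket_left: "Vector_Spaces.linear scale scale (\<lambda>x. bracket x y)"
    and bracket_self: "bracket x x = 0"
    and jacobi: "bracket x (bracket y z) + bracket y (bracket z x) + bracket z (bracket x y) = 0"
begin

definition finite_dimensional :: bool
  where "finite_dimensional \<longleftrightarrow> (\<exists>B. finite B \<and> span B = UNIV)"

text \<open>
  \<open>'b poly\<close> is used as the module of polynomials in an indeterminate \<open>t\<close> with coefficients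
  in the Lie algebra; the function below is \<open>ad (t x + y)\<close> acting on it.
\<close>
definition ad_poly :: "'b \<Rightarrow> 'b \<Rightarrow> 'b poly \<Rightarrow> 'b poly"
  where "ad_poly x y f = pCons 0 (map_poly (bracket x) f) + map_poly (bracket y) f"

text \<open>
  Jacobson's elements \<open>s\<^sub>i(x, y)\<close>: \<open>i s\<^sub>i(x, y)\<close> is the coefficient of \<open>t\<^sup>i\<^sup>-\<^sup>1\<close> in
  \<open>ad (t x + y)\<^sup>p\<^sup>-\<^sup>1 (x)\<close>. Only meaningful for \<open>1 \<le> i \<le> p - 1\<close>.
\<close>
definition jacobson_s :: "nat \<Rightarrow> nat \<Rightarrow> 'b \<Rightarrow> 'b \<Rightarrow> 'b"
  where "jacobson_s p i x y =
    scale (inverse (of_nat i)) (coeff ((ad_poly x y ^^ (p - 1)) [:x:]) (i - 1))"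

definition abelian :: bool
  where "abelian \<longleftrightarrow> (\<forall>x y. bracket x y = 0)"

definition lie_ideal :: "'b set \<Rightarrow> bool"
  where "lie_ideal A \<longleftrightarrow> subspace A \<and> (\<forall>x. \<forall>a\<in>A. bracket x a \<in> A)"

definition almost_abelian :: bool
  where "almost_abelian \<longleftrightarrow>
    (\<exists>x A. lie_ideal A \<and> (\<forall>a\<in>A. \<forall>b\<in>A. bracket a b = 0) \<and>
      span {x} \<inter> A = {0} \<and> (\<forall>v. \<exists>u\<in>span {x}. \<exists>a\<in>A. v = u + a) \<and>
      (\<forall>a\<in>A. bracket x a = a))"

end

locale restricted_lie_algebra = lie_algebra scale bracket
  for scale :: "'a::field \<Rightarrow> 'b::ab_group_add \<Rightarrow> 'b"
    and bracket :: "'b \<Rightarrow> 'b \<Rightarrow> 'b" +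
  fixes p :: nat
    and pmap :: "'b \<Rightarrow> 'b"
  assumes char_eq: "CHAR('a) = p"
    and char_pos: "p > 0"
    and ad_pmap: "bracket (pmap x) y = (bracket x ^^ p) y"
    and pmap_scale: "pmap (scale c x) = scale (c ^ p) (pmap x)"
    and pmap_add: "pmap (x + y) = pmap x + pmap y + (\<Sum>i = 1..p - 1. jacobson_s p i x y)"
begin

definition restricted_subalgebra :: "'b set \<Rightarrow> bool"
  where "restricted_subalgebra S \<longleftrightarrow>
    subspace S \<and> (\<forall>x\<in>S. \<forall>y\<in>S. bracket x y \<in> S) \<and> (\<forall>x\<in>S. pmap x \<in> S)"

definition generated :: "'b set \<Rightarrow> 'b set"
  where "generated X = restricted_subalgebra hull X"

definition maximal_in :: "'b set \<Rightarrow> 'b set \<Rightarrow> bool"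
  where "maximal_in M H \<longleftrightarrow>
    restricted_subalgebra M \<and> restricted_subalgebra H \<and> M \<subset> H \<and>
    \<not> (\<exists>K. restricted_subalgebra K \<and> M \<subset> K \<and> K \<subset> H)"

definition upper_semimodular_in :: "'b set \<Rightarrow> bool"
  where "upper_semimodular_in S \<longleftrightarrow>
    (\<forall>T. restricted_subalgebra T \<longrightarrow> maximal_in (S \<inter> T) T \<longrightarrow>
      maximal_in S (generated (S \<union> T)))"

definition upper_semimodular :: bool
  where "upper_semimodular \<longleftrightarrow>
    (\<forall>S. restricted_subalgebra S \<longrightarrow> upper_semimodular_in S)"

definition generated_by_one_dimensional :: bool
  where "generated_by_one_dimensional \<longleftrightarrow>
    generated (\<Union>{S. restricted_subalgebra S \<and> dim S = 1}) = UNIV"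

end

end

theory Submission
  imports Defs
begin

text \<open>
  Let \<open>x\<close>, \<open>y\<close> span two distinct one-dimensional restricted subalgebras. By upper semimodularity
  \<open>\<langle>x\<rangle>\<close> is maximal in \<open>M = \<langle>x, y\<rangle>\<^sub>p\<close>. Over an algebraically closed field \<open>ad x\<close> has an eigenvector
  on \<open>M / \<langle>x\<rangle>\<close>; if its eigenvalue is zero, the normalizer of \<open>\<langle>x\<rangle>\<close> contains \<open>M\<close>, and otherwise the
  eigenvector lifts to some \<open>w\<close> with \<open>w\<^sup>[\<^sup>p\<^sup>] = 0\<close>, so that \<open>M = \<langle>x, w\<rangle>\<close>. In both cases
  \<open>[x, y] \<in> \<langle>x, y\<rangle>\<close>. Hence the algebra is the linear span of its one-dimensional restricted
  subalgebras. If two of them do not commute, there are a toral \<open>x\<close> and a nilpotent \<open>z\<close> with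
  \<open>[x, z] = z\<close>. Applying the span condition to \<open>y\<close> paired with \<open>x\<close>, \<open>z\<close> and \<open>x + z\<close> yields a linear
  functional \<open>f\<close> with \<open>[x, y] = y - f(y) x\<close> and \<open>[z, y] = - f(y) z\<close>, whose kernel is the required
  abelian ideal.
\<close>

section \<open>Bilinear calculus of the bracket and Jacobson's elements\<close>

context lie_algebra
begin

lemma bracket_add_right: "bracket x (y + z) = bracket x y + bracket x z"
  and bracket_scale_right: "bracket x (scale c y) = scale c (bracket x y)"
  using linear_bracket_right[of x] by (simp_all add: Vector_Spaces.linear_iff)

lemma bracket_add_left: "bracket (x + y) z = bracket x z + bracket y z"
  and bracket_scale_left: "bracket (scale c x) z = scale c (bracket x z)"
  using linear_bracket_left[of z] by (simp_all add: Vector_Spaces.linear_iff)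

lemma bracket_zero_right [simp]: "bracket x 0 = 0"
  using bracket_scale_right[of x 0 0] by simp

lemma bracket_zero_left [simp]: "bracket 0 x = 0"
  using bracket_scale_left[of 0 0 x] by simp

lemma bracket_minus_right: "bracket x (- y) = - bracket x y"
  using bracket_add_right[of x y "- y"] by (simp add: add_eq_0_iff)

lemma bracket_minus_left: "bracket (- x) y = - bracket x y"
  using bracket_add_left[of x "- x" y] by (simp add: add_eq_0_iff)

lemma bracket_diff_right: "bracket x (y - z) = bracket x y - bracket x z"
  using bracket_add_right[of x y "- z"] by (simp add: bracket_minus_right)

lemma bracket_diff_left: "bracket (x - y) z = bracket x z - bracket y z"
  using bracket_add_left[of x "- y" z] by (simp add: bracket_minus_left)

lemma bracket_anticommute: "bracket y x = - bracket x y"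
proof -
  have "bracket y x + bracket x y = 0"
    using bracket_self[of x] bracket_self[of y] bracket_self[of "x + y"]
    by (simp add: bracket_add_left bracket_add_right)
  then show ?thesis
    by (simp only: eq_neg_iff_add_eq_0)
qed

lemmas bracket_simps = bracket_add_right bracket_add_left bracket_scale_right bracket_scale_left
  bracket_diff_right bracket_diff_left bracket_minus_right bracket_minus_left bracket_self

lemma bracket_bracket: "bracket x (bracket y z) = bracket (bracket x y) z + bracket y (bracket x z)"
proof -
  have "bracket x (bracket y z) = - (bracket y (bracket z x) + bracket z (bracket x y))"
    using jacobi[of x y z] by (simp only: eq_neg_iff_add_eq_0 add.assoc)
  then show ?thesis
    using bracket_anticommute[of x z] bracket_anticommute[of "bracket x y" z]
    by (simp add: bracket_minus_right)
qed

lemma span_pair: "v \<in> span {x, y} \<longleftrightarrow> (\<exists>a b. v = scale a x + scale b y)"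
  by (auto simp: span_breakdown_eq[of _ x] span_singleton image_iff diff_eq_eq add.commute)

lemma mem_span_singletonI [simp]: "scale a x \<in> span {x}"
  by (auto simp: span_singleton)

lemma bracket_span:
  assumes "\<And>x y. x \<in> B \<Longrightarrow> y \<in> B \<Longrightarrow> bracket x y \<in> span B"
    and "u \<in> span B" and "v \<in> span B"
  shows "bracket u v \<in> span B"
  using assms(2)
proof (induction rule: span_induct_alt)
  case base
  show ?case by (simp add: span_zero)
next
  case (step c x u)
  have "bracket x v \<in> span B"
    using assms(3)
  proof (induction rule: span_induct_alt)
    case base
    show ?case by (simp add: span_zero)
  next
    case (step d y w)
    then show ?case
      using assms(1)[OF \<open>x \<in> B\<close>] by (simp add: bracket_simps span_add span_scale)
  qed
  then show ?case
    using step by (simp add: bracket_simps span_add span_scale)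
qed

lemma coeff_ad_poly:
  "coeff (ad_poly x y f) i = (if i = 0 then 0 else bracket x (coeff f (i - 1))) + bracket y (coeff f i)"
  by (cases i) (simp_all add: ad_poly_def coeff_map_poly)

text \<open>Each application of \<open>ad (t x + y)\<close> keeps all coefficients in
  \<open>S\<close>, so the elements correcting the additivity of the \<open>p\<close>-map never
  leave a Lie subalgebra.\<close>

lemma jacobson_s_mem:
  assumes "subspace S" and "\<And>u v. u \<in> S \<Longrightarrow> v \<in> S \<Longrightarrow> bracket u v \<in> S"
    and "x \<in> S" and "y \<in> S"
  shows "jacobson_s n i x y \<in> S"
proof -
  have "coeff ((ad_poly x y ^^ k) [:x:]) j \<in> S" for j k
  proof (induction k arbitrary: j)
    case 0
    show ?case
      using assms by (cases j) (auto simp: subspace_0 coeff_pCons)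
  next
    case (Suc k)
    then show ?case
      using assms by (auto simp: coeff_ad_poly intro!: subspace_add subspace_0)
  qed
  then show ?thesis
    by (simp add: jacobson_s_def assms(1) subspace_scale)
qed

text \<open>The first application of \<open>ad (t x + y)\<close> to \<open>x\<close> already gives
  zero. The bound on \<open>n\<close> ensures that there is one, as the power is
  \<open>n - 1\<close>.\<close>

lemma jacobson_s_commuting:
  assumes "bracket x y = 0" and "n \<ge> 2"
  shows "jacobson_s n i x y = 0"
proof -
  have "bracket y x = 0"
    using assms(1) bracket_anticommute[of y x] by simp
  then have 1: "ad_poly x y [:x:] = 0"
    by (simp add: ad_poly_def map_poly_pCons bracket_self)
  have 2: "(ad_poly x y ^^ k) 0 = 0" for k
    by (induction k) (simp_all add: ad_poly_def)
  obtain k where "n - 1 = Suc k"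
    using assms(2) by (cases "n - 1") auto
  then show ?thesis
    by (simp add: jacobson_s_def funpow_Suc_right 1 2 del: funpow.simps)
qed

end

section \<open>Restricted subalgebras and the one-dimensional ones among them\<close>

context restricted_lie_algebra
begin

lemma p_ge_2: "p \<ge> 2"
  using prime_CHAR_semidom[where 'a='a] char_eq char_pos prime_ge_2_nat by auto

lemma pmap_0 [simp]: "pmap 0 = 0"
  using pmap_scale[of 0 0] char_pos by (simp add: power_0_left)

lemma pmap_add_commuting: "bracket x y = 0 \<Longrightarrow> pmap (x + y) = pmap x + pmap y"
  by (simp add: pmap_add jacobson_s_commuting p_ge_2)

text \<open>\<open>ad (pmap z)\<close> is the \<open>p\<close>-th power of \<open>ad z\<close>, and
  \<open>p\<close> is at least 2.\<close>

lemma ad_power_eq_0: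
  assumes "bracket z (bracket z x) = 0"
  shows "bracket (pmap z) x = 0"
proof -
  obtain k where p: "p = Suc (Suc k)"
    using p_ge_2 by (metis add_2_eq_Suc le_Suc_ex)
  have "(bracket z ^^ k) 0 = 0" for k
    by (induction k) simp_all
  then show ?thesis
    using assms by (simp add: ad_pmap p funpow_Suc_right del: funpow.simps)
qed

lemma bracket_pmap_self: "bracket (pmap z) z = 0"
  by (rule ad_power_eq_0) (simp add: bracket_self)

text \<open>Closure can be tested on a spanning set: the bracket is bilinear, and the
  \<open>p\<close>-map is semilinear up to Jacobson's elements, which lie in any subspace closed
  under the bracket.\<close>

lemma restricted_subalgebra_span:
  assumes "\<And>x y. x \<in> B \<Longrightarrow> y \<in> B \<Longrightarrow> bracket x y \<in> span B"
    and "\<And>x. x \<in> B \<Longrightarrow> pmap x \<in> span B"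
  shows "restricted_subalgebra (span B)"
proof -
  have br: "bracket u v \<in> span B" if "u \<in> span B" "v \<in> span B" for u v
    by (rule bracket_span[OF assms(1) that])
  \<comment> \<open>Membership of \<open>u\<close> is carried through the induction because
    \<open>jacobson_s_mem\<close> needs it.\<close>
  have "u \<in> span B \<and> pmap u \<in> span B" if "u \<in> span B" for u
    using that
  proof (induction rule: span_induct_alt)
    case base
    show ?case by (simp add: span_zero)
  next
    case (step c x u)
    have "scale c x \<in> span B"
      using step by (simp add: span_base span_scale)
    moreover from this have "jacobson_s p i (scale c x) u \<in> span B" for i
      using step.IH by (intro jacobson_s_mem[OF subspace_span br]) auto
    moreover have "scale (c ^ p) (pmap x) \<in> span B"
      using step.hyps assms(2) by (simp add: span_scale)
    ultimately show ?case
      unfolding pmap_add pmap_scale using step.IH by (auto intro!: span_add span_sum)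
  qed
  with br show ?thesis
    by (simp add: restricted_subalgebra_def)
qed

lemma restricted_subalgebra_span_pair:
  assumes "bracket x y \<in> span {x, y}" and "pmap x \<in> span {x, y}" and "pmap y \<in> span {x, y}"
  shows "restricted_subalgebra (span {x, y})"
  using assms bracket_anticommute[of y x]
  by (intro restricted_subalgebra_span) (auto simp: bracket_self span_zero span_neg)

lemma restricted_subalgebra_Int:
  "restricted_subalgebra S \<Longrightarrow> restricted_subalgebra T \<Longrightarrow> restricted_subalgebra (S \<inter> T)"
  by (auto simp: restricted_subalgebra_def subspace_inter)

lemma restricted_subalgebra_generated: "restricted_subalgebra (generated X)"
  unfolding generated_def
proof (rule hull_in)
  fix \<S>
  assume "\<forall>S\<in>\<S>. restricted_subalgebra S"
  then show "restricted_subalgebra (\<Inter> \<S>)"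
    by (auto simp: restricted_subalgebra_def intro!: subspace_Inter)
qed

lemma generated_superset: "X \<subseteq> generated X"
  by (simp add: generated_def hull_subset)

lemma generated_minimal: "X \<subseteq> S \<Longrightarrow> restricted_subalgebra S \<Longrightarrow> generated X \<subseteq> S"
  by (simp add: generated_def hull_minimal)

lemma restricted_subalgebra_normalizer:
  "restricted_subalgebra {v. bracket v x \<in> span {x}}"
proof -
  have 1: "bracket v w \<in> span {x}" if "bracket v x \<in> span {x}" "w \<in> span {x}" for v w
    using that by (auto simp: span_singleton bracket_simps)
  have 2: "(bracket v ^^ k) x \<in> span {x}" if "bracket v x \<in> span {x}" for v k
    by (induction k) (use that 1 in \<open>auto simp: span_base\<close>)
  have "bracket (bracket u v) x \<in> span {x}"
    if "bracket u x \<in> span {x}" "bracket v x \<in> span {x}" for u v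
  proof -
    have "bracket (bracket u v) x = bracket u (bracket v x) - bracket v (bracket u x)"
      by (simp add: bracket_bracket[of u v x])
    with that 1 show ?thesis
      by (simp add: span_diff)
  qed
  then show ?thesis
    by (auto simp: restricted_subalgebra_def subspace_def bracket_simps ad_pmap span_add span_scale
        span_zero 2)
qed

lemma restricted_subalgebra_centralizer: "restricted_subalgebra {v. bracket v x = 0}"
proof -
  have "bracket (bracket u v) x = 0" if "bracket u x = 0" "bracket v x = 0" for u v
    using bracket_bracket[of u v x] that by simp
  then show ?thesis
    by (auto simp: restricted_subalgebra_def subspace_def bracket_simps ad_power_eq_0)
qed

text \<open>The span of \<open>x\<close> is a restricted subalgebra of dimension at most one; \<open>pline 0\<close> holds.\<close>
definition pline :: "'b \<Rightarrow> bool"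
  where "pline x \<longleftrightarrow> pmap x \<in> span {x}"

lemma plineE:
  assumes "pline x"
  obtains l where "pmap x = scale l x"
  using assms by (auto simp: pline_def span_singleton)

lemma pline_scale: "pline x \<Longrightarrow> pline (scale c x)"
proof (cases "c = 0")
  case False
  assume "pline x"
  then obtain l where "pmap x = scale l x"
    by (rule plineE)
  then have "pmap (scale c x) = scale (c ^ p * l / c) (scale c x)"
    using False by (simp add: pmap_scale)
  then show ?thesis
    unfolding pline_def by (metis mem_span_singletonI)
qed (simp add: pline_def span_zero)

lemma restricted_subalgebra_pline: "pline x \<Longrightarrow> restricted_subalgebra (span {x})"
  by (intro restricted_subalgebra_span) (auto simp: pline_def bracket_self span_zero)

text \<open>Semimodularity is applied to two distinct lines: they meet in zero, which is maximal in
  a line.\<close>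

lemma pline_maximal:
  assumes "upper_semimodular" and "pline x" and "pline y" and "y \<notin> span {x}"
  shows "maximal_in (span {x}) (generated (span {x} \<union> span {y}))"
proof -
  have int: "span {x} \<inter> span {y} = {0}"
  proof -
    have "v = 0" if v: "v \<in> span {x}" "v \<in> span {y}" for v
    proof (rule ccontr)
      assume "v \<noteq> 0"
      from v obtain b where "v = scale b y"
        by (auto simp: span_singleton)
      with \<open>v \<noteq> 0\<close> have "y = scale (inverse b) v"
        by auto
      with v(1) assms(4) show False
        by (metis span_scale)
    qed
    then show ?thesis
      by (auto simp: span_zero)
  qed
  have "y \<noteq> 0"
    using assms(4) by (auto simp: span_zero)
  have "maximal_in {0} (span {y})"
    unfolding maximal_in_def
  proof (intro conjI notI)
    show "restricted_subalgebra {0}"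
      by (auto simp: restricted_subalgebra_def)
    show "restricted_subalgebra (span {y})"
      by (rule restricted_subalgebra_pline) fact
    show "{0} \<subset> span {y}"
      using \<open>y \<noteq> 0\<close> by (metis span_base singletonI psubsetI empty_subsetI insert_subset span_zero singletonD)
    assume "\<exists>K. restricted_subalgebra K \<and> {0} \<subset> K \<and> K \<subset> span {y}"
    then obtain K v where K: "subspace K" "K \<subset> span {y}" "v \<in> K" "v \<noteq> 0"
      by (auto simp: restricted_subalgebra_def)
    then obtain b where "v = scale b y"
      by (auto simp: span_singleton)
    with \<open>v \<noteq> 0\<close> have "y = scale (inverse b) v"
      by auto
    with K have "y \<in> K"
      by (metis subspace_scale)
    with K show False
      using span_minimal[of "{y}" K] by auto
  qed
  then show ?thesis
    using assms(1) restricted_subalgebra_pline[OF assms(2)] restricted_subalgebra_pline[OF assms(3)]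
    by (simp add: upper_semimodular_def upper_semimodular_in_def int)
qed

text \<open>The bracket condition makes the linear span of the lines a restricted subalgebra; it
  contains the generators.\<close>

lemma span_pline_eq_UNIV:
  assumes gen: "generated_by_one_dimensional"
    and br: "\<And>x y. pline x \<Longrightarrow> pline y \<Longrightarrow> bracket x y \<in> span {x, y}"
  shows "span (Collect pline) = UNIV"
proof -
  have sub: "restricted_subalgebra (span (Collect pline))"
  proof (rule restricted_subalgebra_span)
    fix x y
    assume "x \<in> Collect pline" "y \<in> Collect pline"
    then show "bracket x y \<in> span (Collect pline)"
      using br span_mono[of "{x, y}" "Collect pline"] by auto
  next
    fix x
    assume "x \<in> Collect pline"
    then show "pmap x \<in> span (Collect pline)"
      using span_mono[of "{x}" "Collect pline"] by (auto simp: pline_def)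
  qed
  have "S \<subseteq> span (Collect pline)" if S: "restricted_subalgebra S" "dim S = 1" for S
  proof -
    obtain B where B: "B \<subseteq> S" "S \<subseteq> span B" "card B = dim S"
      by (rule basis_exists[of S])
    then obtain x where x: "B = {x}"
      using S(2) by (auto simp: card_1_singleton_iff)
    with B S have "pline x"
      by (auto simp: pline_def restricted_subalgebra_def)
    with x B show ?thesis
      using span_mono[of "{x}" "Collect pline"] by auto
  qed
  then have "\<Union>{S. restricted_subalgebra S \<and> dim S = 1} \<subseteq> span (Collect pline)"
    by blast
  from generated_minimal[OF this sub] show ?thesis
    using gen by (simp add: generated_by_one_dimensional_def UNIV_I top.extremum_unique)
qed

end

section \<open>Eigenvectors of \<open>ad x\<close> modulo a subspace\<close>

locale alg_closed_restricted_lie_algebra = restricted_lie_algebra scale bracket p pmap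
  for scale :: "'a::alg_closed_field \<Rightarrow> 'b::ab_group_add \<Rightarrow> 'b"
    and bracket :: "'b \<Rightarrow> 'b \<Rightarrow> 'b" and p :: nat and pmap :: "'b \<Rightarrow> 'b"
begin

text \<open>\<open>ad_eval x y q\<close> is \<open>q(ad x) y\<close>, computed by Horner's scheme.\<close>
definition ad_eval :: "'b \<Rightarrow> 'b \<Rightarrow> 'a poly \<Rightarrow> 'b"
  where "ad_eval x y q = fold_coeffs (\<lambda>a v. scale a y + bracket x v) q 0"

lemma ad_eval_0 [simp]: "ad_eval x y 0 = 0"
  by (simp add: ad_eval_def)

lemma ad_eval_pCons [simp]: "ad_eval x y (pCons a q) = scale a y + bracket x (ad_eval x y q)"
  by (cases "a = 0 \<and> q = 0") (auto simp: ad_eval_def)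

lemma ad_eval_smult: "ad_eval x y (smult c q) = scale c (ad_eval x y q)"
  by (induction q) (simp_all add: bracket_simps scale_right_distrib)

lemma ad_eval_add: "ad_eval x y (q + r) = ad_eval x y q + ad_eval x y r"
  by (induction q r rule: poly_induct2) (simp_all add: bracket_simps scale_left_distrib)

lemma ad_eval_monom: "ad_eval x y (monom c n) = scale c ((bracket x ^^ n) y)"
  by (induction n) (simp_all add: monom_0 monom_Suc bracket_simps)

lemma ad_eval_mem:
  assumes "restricted_subalgebra M" and "x \<in> M" and "y \<in> M"
  shows "ad_eval x y q \<in> M"
  by (induction q)
    (use assms in \<open>auto simp: restricted_subalgebra_def subspace_0 subspace_add subspace_scale\<close>)

text \<open>Induction on the degree of an annihilator \<open>q\<close> of \<open>y\<close> modulo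
  \<open>W\<close>. Split off a root \<open>r\<close>, leaving \<open>s\<close>: either
  \<open>s(ad x) y\<close> is outside \<open>W\<close> and is the eigenvector, or \<open>s\<close>
  is an annihilator of smaller degree. A nonzero constant would put \<open>y\<close> into
  \<open>W\<close>.\<close>

lemma ad_eigenvector_mod_aux:
  assumes "subspace W" and "y \<notin> W" and "q \<noteq> 0" and "ad_eval x y q \<in> W"
  shows "\<exists>r s. ad_eval x y s \<notin> W \<and> bracket x (ad_eval x y s) - scale r (ad_eval x y s) \<in> W"
  using assms(3,4)
proof (induction "degree q" arbitrary: q)
  case 0
  then obtain c where c: "q = [:c:]" "c \<noteq> 0"
    by (metis degree_eq_zeroE pCons_0_0)
  with 0 have "scale (inverse c) (scale c y) \<in> W"
    using subspace_scale[OF assms(1)] by (simp del: scale_scale)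
  with c assms(2) show ?case
    by simp
next
  case (Suc n)
  then obtain r where "poly q r = 0"
    using alg_closed_imp_poly_has_root[of q] by auto
  then obtain s where s: "q = [:- r, 1:] * s"
    by (auto simp: poly_eq_0_iff_dvd)
  with Suc have "s \<noteq> 0"
    by auto
  have ev: "ad_eval x y q = bracket x (ad_eval x y s) - scale r (ad_eval x y s)"
    using ad_eval_add[of x y "smult (- r) s" "pCons 0 s"] by (simp add: s ad_eval_smult flip: smult_minus_left)
  show ?case
  proof (cases "ad_eval x y s \<in> W")
    case True
    have "degree q = Suc (degree s)"
      using \<open>s \<noteq> 0\<close> by (simp add: s degree_mult_eq del: mult_pCons_left)
    with Suc True \<open>s \<noteq> 0\<close> show ?thesis
      by auto
  next
    case False
    with ev Suc show ?thesis
      by metis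
  qed
qed

lemma ad_eigenvector_mod:
  assumes "pline x" and "y \<notin> span {x}" and "restricted_subalgebra M" and "x \<in> M" and "y \<in> M"
  obtains z r where "z \<in> M" and "z \<notin> span {x}" and "bracket x z - scale r z \<in> span {x}"
proof -
  from assms(1) obtain l where l: "pmap x = scale l x"
    by (rule plineE)
  \<comment> \<open>The annihilator is \<open>T^p - l T\<close>, since
    \<open>(ad x)^p = ad (pmap x) = l ad x\<close>.\<close>
  have "coeff (monom 1 p - monom l 1 :: 'a poly) p = 1"
    using p_ge_2 by simp
  then have "(monom 1 p - monom l 1 :: 'a poly) \<noteq> 0"
    by (metis coeff_0 zero_neq_one)
  moreover have "ad_eval x y (monom 1 p - monom l 1) = 0"
    using ad_eval_add[of x y "monom 1 p" "monom (- l) 1"] ad_pmap[of x y]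
    by (simp add: ad_eval_monom l bracket_simps minus_monom diff_conv_add_uminus
        del: add_uminus_conv_diff)
  ultimately show thesis
    using ad_eigenvector_mod_aux[of "span {x}" y "monom 1 p - monom l 1" x] ad_eval_mem[OF assms(3-5)]
      assms(2) that
    by (auto simp: span_zero)
qed

section \<open>The span condition for two one-dimensional restricted subalgebras\<close>

text \<open>A restricted subalgebra between \<open>span {x}\<close> and \<open>M\<close> is one of
  the two. This is used for the normalizer and the centralizer of \<open>x\<close> in
  \<open>M\<close>, and for \<open>span {x, w}\<close>.\<close>

lemma bracket_mem_span_pline:
  assumes "upper_semimodular" and "pline x" and "pline y"
  shows "bracket x y \<in> span {x, y}"
proof (cases "y \<in> span {x}")
  case True
  then show ?thesis
    by (auto simp: span_singleton bracket_simps span_zero)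
next
  case False
  define M where "M = generated (span {x} \<union> span {y})"
  have M: "restricted_subalgebra M" "x \<in> M" "y \<in> M"
    using restricted_subalgebra_generated generated_superset[of "span {x} \<union> span {y}"]
    by (auto simp: M_def span_base)
  have max: "K = span {x} \<or> K = M" if "restricted_subalgebra K" "x \<in> K" "K \<subseteq> M" for K
  proof -
    have "span {x} \<subseteq> K"
      using that by (intro span_minimal) (auto simp: restricted_subalgebra_def)
    then show ?thesis
      using pline_maximal[OF assms False] that by (auto simp: maximal_in_def M_def)
  qed
  obtain z r where z: "z \<in> M" "z \<notin> span {x}" and r: "bracket x z - scale r z \<in> span {x}"
    using ad_eigenvector_mod[OF assms(2) False M] by blast
  show ?thesis
  proof (cases "r = 0")
    case True
    define N where "N = {v. bracket v x \<in> span {x}} \<inter> M"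
    have "z \<in> N"
      using True r z bracket_anticommute[of z x] by (simp add: N_def span_neg)
    moreover have "restricted_subalgebra N"
      unfolding N_def by (intro restricted_subalgebra_Int restricted_subalgebra_normalizer M)
    ultimately have "N = M"
      using max[of N] z M by (auto simp: N_def bracket_self span_zero)
    with M have "bracket y x \<in> span {x}"
      by (auto simp: N_def)
    then have "bracket x y \<in> span {x}"
      using bracket_anticommute[of x y] by (simp add: span_neg)
    then show ?thesis
      using span_mono[of "{x}" "{x, y}"] by auto
  next
    case False
    from r obtain m where "bracket x z - scale r z = scale m x"
      by (auto simp: span_singleton)
    then have m: "bracket x z = scale r z + scale m x"
      by (simp add: diff_eq_eq add.commute)
    \<comment> \<open>The shift absorbs \<open>m x\<close>, turning an eigenvector modulo
      \<open>span {x}\<close> into a true one.\<close>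
    define w where "w = z + scale (m / r) x"
    have w: "bracket x w = scale r w"
      using False by (simp add: w_def bracket_simps m scale_right_distrib)
    have "w \<in> M"
      using M z by (auto simp: w_def restricted_subalgebra_def intro!: subspace_add subspace_scale)
    have "w \<notin> span {x}"
    proof
      assume "w \<in> span {x}"
      then have "w - scale (m / r) x \<in> span {x}"
        by (simp add: span_diff)
      with z show False
        by (simp add: w_def)
    qed
    then have "w \<noteq> 0"
      by (auto simp: span_zero)
    have wx: "bracket w x = - scale r w"
      using w bracket_anticommute[of w x] by simp
    define C where "C = {v. bracket v x = 0} \<inter> M"
    have "restricted_subalgebra C"
      unfolding C_def by (intro restricted_subalgebra_Int restricted_subalgebra_centralizer M)
    moreover have "w \<notin> C"
      using wx False \<open>w \<noteq> 0\<close> by (simp add: C_def)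
    ultimately have "C = span {x}"
      using max[of C] \<open>w \<in> M\<close> M by (auto simp: C_def bracket_self)
    \<comment> \<open>\<open>[w, x]\<close> is a multiple of \<open>w\<close>, so
      \<open>[w, [w, x]] = 0\<close> and \<open>pmap w\<close> centralizes \<open>x\<close>.\<close>
    moreover have "pmap w \<in> C"
      using M \<open>w \<in> M\<close> wx by (auto simp: C_def restricted_subalgebra_def bracket_simps intro!: ad_power_eq_0)
    ultimately obtain a where a: "pmap w = scale a x"
      by (auto simp: span_singleton)
    \<comment> \<open>\<open>pmap w\<close> commutes with \<open>w\<close>, whereas
      \<open>a x\<close> multiplies \<open>w\<close> by \<open>a r\<close>; hence
      \<open>a = 0\<close>.\<close>
    have "scale (a * r) w = 0"
      using bracket_pmap_self[of w] by (simp add: a bracket_simps w)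
    with False \<open>w \<noteq> 0\<close> have "pmap w = 0"
      by (simp add: a)
    have K: "restricted_subalgebra (span {x, w})"
      using assms(2) span_mono[of "{x}" "{x, w}"] \<open>pmap w = 0\<close>
      by (intro restricted_subalgebra_span_pair) (auto simp: w span_base span_scale span_zero pline_def)
    have "span {x, w} \<subseteq> M"
      using M \<open>w \<in> M\<close> by (intro span_minimal) (auto simp: restricted_subalgebra_def)
    then have "span {x, w} = M"
      using max[OF K] \<open>w \<notin> span {x}\<close> by (auto simp: span_base)
    then obtain b c where y: "y = scale b x + scale c w"
      using M by (auto simp: span_pair)
    have "bracket x y = scale r (y - scale b x)"
      by (simp add: y bracket_simps w mult.commute)
    also have "\<dots> \<in> span {x, y}"
      by (intro span_scale span_diff span_base) auto
    finally show ?thesis .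
  qed
qed

section \<open>Toral and nilpotent elements in the nonabelian case\<close>

lemma toral_nil_pair:
  assumes "upper_semimodular" and "pline u" and "pline v" and "bracket u v \<noteq> 0"
  obtains x z where "bracket x z = z" and "z \<noteq> 0" and "pmap x = x" and "pmap z = 0"
proof -
  \<comment> \<open>The case of a nonzero coefficient of \<open>v\<close>; the other one follows by
    exchanging \<open>u\<close> and \<open>v\<close>.\<close>
  have *: "\<exists>x z. bracket x z = z \<and> z \<noteq> 0 \<and> pmap x = x \<and> pmap z = 0"
    if "pline u" "pline v" "bracket u v = scale a u + scale b v" "b \<noteq> 0"
    "bracket u v \<noteq> 0" for u v a b
  proof -
    \<comment> \<open>\<open>[u, z] = [u, a u + b v] = b z\<close>, so dividing \<open>u\<close> by
      \<open>b\<close> makes it act on \<open>z\<close> as the identity.\<close>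
    define x where "x = scale (inverse b) u"
    define z where "z = bracket u v"
    have xz: "bracket x z = z"
      using that(3,4) by (simp add: x_def z_def bracket_simps)
    then have zx: "bracket z x = - z"
      using bracket_anticommute[of z x] by simp
    have "z \<noteq> 0"
      using that by (simp add: z_def)
    have "pline x"
      using that by (simp add: x_def pline_scale)
    then obtain l where l: "pmap x = scale l x"
      by (rule plineE)
    have "(bracket x ^^ n) z = z" for n
      by (induction n) (simp_all add: xz)
    \<comment> \<open>\<open>ad (pmap x)\<close> acts on \<open>z\<close> both as \<open>l\<close>
      and as the \<open>p\<close>-th power of the identity, which forces
      \<open>l = 1\<close>.\<close>
    then have "scale l z = z"
      using ad_pmap[of x z] by (simp add: l bracket_simps xz)
    then have "scale (l - 1) z = 0"
      by (simp add: scale_left_diff_distrib)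
    with \<open>z \<noteq> 0\<close> have "pmap x = x"
      by (simp add: l)
    have "restricted_subalgebra (span {u, v})"
      using that assms span_mono[of "{u}" "{u, v}"] span_mono[of "{v}" "{u, v}"]
      by (intro restricted_subalgebra_span_pair bracket_mem_span_pline) (auto simp: pline_def)
    moreover have "z \<in> span {u, v}"
      unfolding z_def by (intro bracket_mem_span_pline assms that)
    ultimately have "pmap z \<in> span {u, v}"
      by (auto simp: restricted_subalgebra_def)
    then obtain c d where cd: "pmap z = scale c u + scale d v"
      by (auto simp: span_pair)
    have u: "u = scale b x"
      using that by (simp add: x_def)
    have v: "v = scale (inverse b) z - scale a x"
      using that by (simp add: z_def x_def scale_right_distrib mult.commute)
    \<comment> \<open>In terms of \<open>x\<close> and \<open>z\<close>, bracketing with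
      \<open>x\<close> detects the coefficient of \<open>z\<close>, and bracketing with
      \<open>z\<close> that of \<open>x\<close>. Both brackets vanish.\<close>
    have z': "pmap z = scale (c * b - d * a) x + scale (d / b) z"
      by (simp add: cd v) (simp add: u scale_left_diff_distrib scale_right_diff_distrib divide_inverse)
    have zx0: "bracket (pmap z) x = 0"
      by (rule ad_power_eq_0) (simp add: zx bracket_simps)
    have "scale (d / b) z = 0"
      using zx0 by (simp add: z' bracket_simps zx)
    moreover have "scale (c * b - d * a) z = 0"
      using bracket_pmap_self[of z] by (simp add: z' bracket_simps xz)
    ultimately have "pmap z = 0"
      using \<open>z \<noteq> 0\<close> by (simp add: z')
    with xz \<open>z \<noteq> 0\<close> \<open>pmap x = x\<close> show ?thesis
      by blast
  qed
  obtain a b where ab: "bracket u v = scale a u + scale b v"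
    using bracket_mem_span_pline[OF assms(1-3)] by (auto simp: span_pair)
  show thesis
  proof (cases "b = 0")
    case True
    then have "bracket v u = scale 0 v + scale (- a) u" "- a \<noteq> 0" "bracket v u \<noteq> 0"
      using ab assms(4) bracket_anticommute[of v u] by auto
    from *[OF assms(3,2) this] obtain x z where "bracket x z = z" "z \<noteq> 0" "pmap x = x" "pmap z = 0"
      by blast
    then show thesis
      by (rule that)
  next
    case False
    with *[OF assms(2,3) ab _ assms(4)]
    obtain x z where "bracket x z = z" "z \<noteq> 0" "pmap x = x" "pmap z = 0"
      by blast
    then show thesis
      by (rule that)
  qed
qed

text \<open>Linear independence of \<open>x\<close>, \<open>y\<close>, \<open>z\<close>, in the form
  used for comparing coefficients. That \<open>x\<close> and \<open>z\<close> are independent is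
  seen by applying \<open>ad z\<close>.\<close>

lemma scale_combination_eq_0:
  assumes "bracket x z = z" and "z \<noteq> 0" and "y \<notin> span {x, z}"
    and "scale a x + scale b y + scale c z = 0"
  shows "a = 0" and "b = 0" and "c = 0"
proof -
  show "b = 0"
  proof (rule ccontr)
    assume "b \<noteq> 0"
    have "scale b y = scale (- a) x + scale (- c) z"
      using assms(4) by (simp add: add_eq_0_iff algebra_simps)
    then have "scale b y \<in> span {x, z}"
      unfolding span_pair by blast
    then have "scale (inverse b) (scale b y) \<in> span {x, z}"
      by (rule span_scale)
    with \<open>b \<noteq> 0\<close> assms(3) show False
      by simp
  qed
  have zx: "bracket z x = - z"
    using assms(1) bracket_anticommute[of z x] by simp
  have 0: "scale a x + scale c z = 0"
    using assms(4) \<open>b = 0\<close> by simp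
  have "bracket z (scale a x + scale c z) = scale (- a) z"
    by (simp add: bracket_simps zx)
  with 0 assms(2) show "a = 0"
    by simp
  with 0 assms(2) show "c = 0"
    by simp
qed

text \<open>Jacobson's sum is not evaluated: \<open>pmap (x + z)\<close> lies in
  \<open>span {x, z}\<close>, and its coefficients are read off from its action on \<open>z\<close>
  and on \<open>x\<close>.\<close>

lemma pline_toral_add_nil:
  assumes "bracket x z = z" and "pmap x = x" and "pmap z = 0" and "z \<noteq> 0"
  shows "pmap (x + z) = x + z"
proof -
  have zx: "bracket z x = - z"
    using assms(1) bracket_anticommute[of z x] by simp
  have "restricted_subalgebra (span {x, z})"
    by (intro restricted_subalgebra_span_pair) (simp_all add: assms span_base span_zero)
  then have "pmap (x + z) \<in> span {x, z}"
    by (auto simp: restricted_subalgebra_def span_base span_add)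
  then obtain a b where ab: "pmap (x + z) = scale a x + scale b z"
    by (auto simp: span_pair)
  have z: "(bracket (x + z) ^^ n) z = z" for n
    by (induction n) (simp_all add: assms bracket_simps)
  \<comment> \<open>The iterates are constant only from the first one on; the zeroth is
    \<open>x\<close>.\<close>
  have "(bracket (x + z) ^^ Suc n) x = - z" for n
    by (induction n) (simp_all add: assms zx bracket_simps)
  from this[of "p - 1"] have x: "(bracket (x + z) ^^ p) x = - z"
    using char_pos by simp
  have "scale a z = z" "scale b z = z"
    using ad_pmap[of "x + z" z] ad_pmap[of "x + z" x] by (simp_all add: x z ab bracket_simps assms zx)
  then have "scale (a - 1) z = 0" "scale (b - 1) z = 0"
    by (simp_all add: scale_left_diff_distrib)
  with assms(4) show ?thesis
    by (simp add: ab)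
qed

text \<open>\<open>pmap (c y) = c^p l y\<close>, so \<open>c\<close> must be a
  \<open>(p - 1)\<close>-th root of \<open>1 / l\<close>.\<close>

lemma toral_scale:
  assumes "pmap y = scale l y" and "l \<noteq> 0"
  obtains c where "c \<noteq> 0" and "pmap (scale c y) = scale c y"
proof -
  obtain c where c: "c ^ (p - 1) = inverse l"
    using nth_root_exists[of "p - 1" "inverse l"] p_ge_2 by auto
  have "p - 1 > 0"
    using p_ge_2 by simp
  with c assms(2) have "c \<noteq> 0"
    by (auto simp: power_0_left)
  have "c ^ p = c * inverse l"
    using c char_pos by (metis Suc_diff_1 power_Suc)
  with assms that[OF \<open>c \<noteq> 0\<close>] show thesis
    by (simp add: pmap_scale)
qed

section \<open>The linear functional \<open>f\<close> and its kernel\<close>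

text \<open>The constant \<open>c\<close> is \<open>f(y)\<close>. Pairing \<open>y\<close> with
  \<open>x\<close>, \<open>z\<close> and \<open>x + z\<close> and applying the Jacobi identity leave
  only the eigenvalue \<open>b\<close> to be determined.\<close>

lemma pline_bracket_toral_nil_pair:
  assumes usm: "upper_semimodular"
    and xz: "bracket x z = z" and z0: "z \<noteq> 0" and px: "pmap x = x" and pz: "pmap z = 0"
    and y: "pline y"
  shows "\<exists>c. bracket x y = y - scale c x \<and> bracket z y = - scale c z"
proof (cases "y \<in> span {x, z}")
  case True
  then obtain a b where "y = scale a x + scale b z"
    by (auto simp: span_pair)
  \<comment> \<open>Here \<open>f\<close> is the coefficient of \<open>x\<close>.\<close>
  then show ?thesis
    using bracket_anticommute[of z x] by (intro exI[of _ a]) (simp add: bracket_simps xz)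
next
  case False
  note indep = scale_combination_eq_0[OF xz z0 False]
  have zx: "bracket z x = - z"
    using xz bracket_anticommute[of z x] by simp
  have pl: "pline x" "pline z" "pline (x + z)"
    using pline_toral_add_nil[OF xz px pz z0] by (simp_all add: pline_def px pz span_zero span_base)
  obtain a b where xy: "bracket x y = scale a x + scale b y"
    using bracket_mem_span_pline[OF usm pl(1) y] by (auto simp: span_pair)
  obtain c d where zy: "bracket z y = scale c z + scale d y"
    using bracket_mem_span_pline[OF usm pl(2) y] by (auto simp: span_pair)
  obtain e f where "bracket (x + z) y = scale e (x + z) + scale f y"
    using bracket_mem_span_pline[OF usm pl(3) y] by (auto simp: span_pair)
  then have "scale (a - e) x + scale (b + d - f) y + scale (c - e) z = 0"
    by (simp add: bracket_simps xy zy algebra_simps)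
  from indep[OF this] have "c = a"
    by simp
  have "bracket x (bracket z y) = bracket z y + bracket z (bracket x y)"
    using bracket_bracket[of x z y] by (simp add: xz)
  then have "scale (d * a) x + scale (- d) y + scale (a - b * a) z = 0"
    by (simp add: bracket_simps xy zy xz zx \<open>c = a\<close> algebra_simps)
  from indep[OF this] have d: "d = 0" and ab: "a * (1 - b) = 0"
    by (simp_all add: algebra_simps)
  have "b = 1"
  proof (rule ccontr)
    assume "b \<noteq> 1"
    with ab have "a = 0"
      by simp
    have xy': "bracket x y = scale b y" and zy': "bracket z y = 0"
      by (simp_all add: xy zy \<open>c = a\<close> d \<open>a = 0\<close>)
    have yx: "bracket y x = - scale b y"
      using xy' bracket_anticommute[of y x] by simp
    obtain l where l: "pmap y = scale l y"
      using y by (rule plineE)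
    show False
    proof (cases "l = 0")
      case True
      \<comment> \<open>\<open>z + y\<close> is a sum of eigenvectors of \<open>ad x\<close> for 1
        and \<open>b\<close>; the span condition for it and \<open>x\<close> forces these
        eigenvalues to agree.\<close>
      then have "pline (z + y)"
        using zy' by (simp add: pline_def pmap_add_commuting pz l span_zero)
      then have "bracket x (z + y) \<in> span {x, z + y}"
        by (rule bracket_mem_span_pline[OF usm pl(1)])
      then obtain g h where "bracket x (z + y) = scale g x + scale h (z + y)"
        by (auto simp: span_pair)
      then have "scale (- g) x + scale (b - h) y + scale (1 - h) z = 0"
        by (simp add: bracket_simps xz xy' algebra_simps)
      from indep[OF this] \<open>b \<noteq> 1\<close> show False
        by simp
    next
      case False
      \<comment> \<open>\<open>[y, x]\<close> is a multiple of \<open>y\<close>, so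
        \<open>pmap y = l y\<close> commutes with \<open>x\<close>.\<close>
      have "scale (l * b) y = 0"
        using ad_power_eq_0[of y x] by (simp add: l bracket_simps yx)
      moreover have "y \<noteq> 0"
        using \<open>y \<notin> span {x, z}\<close> by (auto simp: span_zero)
      ultimately have "b = 0"
        using False by simp
      \<comment> \<open>A toral \<open>k y\<close> commuting with \<open>x\<close> and \<open>z\<close> makes \<open>x + z + k y\<close> toral, and
        \<open>[x, x + z + k y] = z\<close> violates the span condition.\<close>
      obtain k where k: "k \<noteq> 0" "pmap (scale k y) = scale k y"
        using toral_scale[OF l False] .
      have "pmap (x + z + scale k y) = x + z + scale k y"
        using pmap_add_commuting[of "x + z" "scale k y"] pline_toral_add_nil[OF xz px pz z0]
        by (simp add: bracket_simps xy' zy' \<open>b = 0\<close> k)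
      then have "pline (x + z + scale k y)"
        by (simp add: pline_def span_base)
      then have "bracket x (x + z + scale k y) \<in> span {x, x + z + scale k y}"
        by (rule bracket_mem_span_pline[OF usm pl(1)])
      then obtain g h where "bracket x (x + z + scale k y) = scale g x + scale h (x + z + scale k y)"
        by (auto simp: span_pair)
      then have "scale (- g - h) x + scale (- h * k) y + scale (1 - h) z = 0"
        by (simp add: bracket_simps xz xy' \<open>b = 0\<close> algebra_simps)
      from indep[OF this] k show False
        by simp
    qed
  qed
  then show ?thesis
    by (intro exI[of _ "- a"]) (simp add: xy zy d \<open>c = a\<close>)
qed

text \<open>The ideal \<open>A\<close> is the kernel of \<open>f\<close>, which is the eigenspace of
  \<open>ad x\<close> for 1 because \<open>x\<close> is nonzero. By the Jacobi identity,
  \<open>ad x\<close> doubles \<open>[a, b]\<close> for \<open>a\<close>, \<open>b\<close> in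
  \<open>A\<close>. Since \<open>z\<close> centralizes \<open>[a, b]\<close>, its constant is zero
  and \<open>ad x\<close> also fixes it, so \<open>[a, b] = 0\<close>.\<close>

lemma almost_abelian_if_toral_nil_pair:
  assumes xz: "bracket x z = z" and z0: "z \<noteq> 0"
    and br: "\<And>y. \<exists>c. bracket x y = y - scale c x \<and> bracket z y = - scale c z"
  shows "almost_abelian"
proof -
  define A where "A = {a. bracket x a = a}"
  have "x \<noteq> 0"
    using xz z0 by auto
  have zA: "bracket z a = 0" if "a \<in> A" for a
    using br[of a] that \<open>x \<noteq> 0\<close> by (auto simp: A_def)
  have AA: "bracket a b = 0" if "a \<in> A" "b \<in> A" for a b
  proof -
    obtain c where c: "bracket x (bracket a b) = bracket a b - scale c x"
      "bracket z (bracket a b) = - scale c z"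
      using br by blast
    have "bracket z (bracket a b) = 0"
      using bracket_bracket[of z a b] that zA by simp
    with c(2) z0 have "c = 0"
      by simp
    have "bracket x (bracket a b) = bracket a b + bracket a b"
      using bracket_bracket[of x a b] that by (simp add: A_def)
    with c(1) \<open>c = 0\<close> show ?thesis
      by simp
  qed
  have sub: "subspace A"
    by (auto simp: A_def subspace_def bracket_simps)
  have dec: "\<exists>u\<in>span {x}. \<exists>a\<in>A. v = u + a" for v
  proof -
    obtain c where "bracket x v = v - scale c x"
      using br by blast
    then have "v - scale c x \<in> A"
      by (simp add: A_def bracket_simps)
    then show ?thesis
      by (intro bexI[of _ "scale c x"] bexI[of _ "v - scale c x"]) auto
  qed
  have "bracket v a \<in> A" if "a \<in> A" for v a
  proof -
    obtain c b where "v = scale c x + b" "b \<in> A"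
      using dec[of v] by (auto simp: span_singleton)
    with that have "bracket v a = scale c a"
      by (simp add: bracket_simps AA) (simp add: A_def)
    with that sub show ?thesis
      by (simp add: subspace_scale)
  qed
  moreover have "span {x} \<inter> A = {0}"
    using span_zero by (auto simp: A_def span_singleton bracket_simps)
  ultimately show ?thesis
    unfolding almost_abelian_def lie_ideal_def
  proof (intro exI[of _ x] exI[of _ A] conjI)
    show "\<forall>a\<in>A. bracket x a = a"
      by (simp add: A_def)
  qed (use sub AA dec in \<open>simp_all\<close>)
qed

theorem abelian_or_almost_abelian:
  assumes "upper_semimodular" and "generated_by_one_dimensional"
  shows "abelian \<or> almost_abelian"
proof (cases "\<exists>u v. pline u \<and> pline v \<and> bracket u v \<noteq> 0")
  case False
  have UNIV: "span (Collect pline) = UNIV"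
    by (rule span_pline_eq_UNIV) (use assms bracket_mem_span_pline in auto)
  have "bracket u v = 0" for u v
  proof -
    \<comment> \<open>Commutation passes from the lines to their span in one argument at a
      time.\<close>
    have sub: "subspace {v. bracket u v = 0}" "subspace {u. bracket u v = 0}" for u v
      by (auto simp: subspace_def bracket_simps)
    have "bracket u v = 0" if "pline u" for u v
      using span_minimal[OF _ sub(1), of "Collect pline" u] False that UNIV by blast
    then show ?thesis
      using span_minimal[OF _ sub(2), of "Collect pline" v] UNIV by blast
  qed
  then show ?thesis
    by (simp add: abelian_def)
next
  case True
  then obtain x z where xz: "bracket x z = z" "z \<noteq> 0" "pmap x = x" "pmap z = 0"
    using toral_nil_pair assms(1) by metis
  \<comment> \<open>The constant can be chosen additively and homogeneously in \<open>y\<close>, so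
    \<open>P\<close> is a subspace; it contains all lines and hence everything.\<close>
  define P where "P = {y. \<exists>c. bracket x y = y - scale c x \<and> bracket z y = - scale c z}"
  have "Collect pline \<subseteq> P"
    using pline_bracket_toral_nil_pair[OF assms(1) xz] by (auto simp: P_def)
  moreover have "subspace P"
    unfolding subspace_def
  proof (intro conjI ballI allI)
    show "0 \<in> P"
      by (auto simp: P_def intro!: exI[of _ 0])
  next
    fix u v
    assume "u \<in> P" "v \<in> P"
    then obtain c d where "bracket x u = u - scale c x" "bracket z u = - scale c z"
      "bracket x v = v - scale d x" "bracket z v = - scale d z"
      by (auto simp: P_def)
    then show "u + v \<in> P"
      by (auto simp: P_def bracket_simps scale_left_distrib intro!: exI[of _ "c + d"])
  next
    fix e u
    assume "u \<in> P"
    then obtain c where "bracket x u = u - scale c x" "bracket z u = - scale c z"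
      by (auto simp: P_def)
    then show "scale e u \<in> P"
      by (auto simp: P_def bracket_simps scale_right_diff_distrib intro!: exI[of _ "e * c"])
  qed
  ultimately have "span (Collect pline) \<subseteq> P"
    by (rule span_minimal)
  moreover have "span (Collect pline) = UNIV"
    by (rule span_pline_eq_UNIV) (use assms bracket_mem_span_pline in auto)
  ultimately have "almost_abelian"
    by (intro almost_abelian_if_toral_nil_pair[OF xz(1,2)]) (auto simp: P_def)
  then show ?thesis ..
qed

end

theorem proposition6p4:
  fixes scale :: "'a::alg_closed_field \<Rightarrow> 'b::ab_group_add \<Rightarrow> 'b"
    and bracket :: "'b \<Rightarrow> 'b \<Rightarrow> 'b"
    and p :: nat
    and pmap :: "'b \<Rightarrow> 'b"
  assumes "restricted_lie_algebra scale bracket p pmap"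
    and "lie_algebra.finite_dimensional scale"
    and "restricted_lie_algebra.upper_semimodular scale bracket pmap"
    and "restricted_lie_algebra.generated_by_one_dimensional scale bracket pmap"
  shows "lie_algebra.abelian bracket \<or> lie_algebra.almost_abelian scale bracket"
proof -
  interpret restricted_lie_algebra scale bracket p pmap
    by fact
  interpret alg_closed_restricted_lie_algebra scale bracket p pmap ..
  show ?thesis
    using assms by (intro abelian_or_almost_abelian)
qed

end
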